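(* Let $m,n,l\ge1$ be integers with $2^l\mid n$, let $\beta_1,\beta_2\in[0,1)$, $\epsilon>0$, and let $(G_t)_{t\ge0}$ be a sequence of matrices in $\mathbb{R}^{m\times n}$ with level-$l$ Haar approximation coefficients $A_t^{(l)}$. Let $\widehat M_{t+1}^A$ and $S_{t+1}^A$ be the bias-corrected first moment and the approximation preconditioner defined in the context, with $M_0^A=0$, and let $\Xi_t^A=\widehat M_{t+1}^A-A_t^{(l)}$. For $t\ge0$, $q=0,\ldots,t$ and $u=0,\ldots,t-1$, define $$\omega_{t,q}=\frac{(1-\beta_1)\beta_1^{t-q}}{1-\beta_1^{t+1}},\qquad c_{t,u}=\frac{\beta_1^{t-u}(1-\beta_1^{u+1})}{1-\beta_1^{t+1}}.$$ Then for every $t\ge0$, $$\widehat M_{t+1}^A=\sum_{q=0}^{t}\omega_{t,q}A_q^{(l)},\qquad \Xi_t^A=-\sum_{u=0}^{t-1}c_{t,u}\big(A_{u+1}^{(l)}-A_u^{(l)}\big).$$ Consequently, $$\left\|(S_{t+1}^{A})^{1/2}\odot\Xi_t^A\right\|_F\le\sum_{u=0}^{t-1}c_{t,u}\left\|(S_{t+1}^{A})^{1/2}\odot\big(A_{u+1}^{(l)}-A_u^{(l)}\big)\right\|_F ,$$ and for $t=0$ both sides of this last inequality are zero.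
   Context: $\|\cdot\|_F$ is the Frobenius norm; $\odot$ is the element-wise product; all squares, square roots, divisions and powers of matrices are element-wise. The convention $0^0=1$ is used for scalar powers, and empty sums are zero. Haar approximation coefficients. For even $s$, the Haar matrix $H_s\in\mathbb{R}^{s\times s}$ (which is orthogonal) has, for $i=1,\ldots,s/2$, entries $(H_s)_{2i-1,i}=(H_s)_{2i,i}=(H_s)_{2i-1,s/2+i}=\frac1{\sqrt2}$ and $(H_s)_{2i,s/2+i}=-\frac1{\sqrt2}$, all other entries being zero. Set $A_t^{(0)}=G_t$ and, for $j=1,\ldots,l$, define $A_t^{(j)},D_t^{(j)}\in\mathbb{R}^{m\times n/2^j}$ by $[A_t^{(j)},D_t^{(j)}]=A_t^{(j-1)}H_{n/2^{j-1}}$ (the first $n/2^j$ columns form $A_t^{(j)}$, the remaining ones $D_t^{(j)}$). Moments and preconditioner. With $M_0^A=V_0^A=0\in\mathbb{R}^{m\times n/2^l}$, for $t\ge0$, $$M_{t+1}^A=\beta_1M_t^A+(1-\beta_1)A_t^{(l)},\quad V_{t+1}^A=\beta_2V_t^A+(1-\beta_2)(A_t^{(l)})^2,$$ $$\widehat M_{t+1}^A=\frac{M_{t+1}^A}{1-\beta_1^{t+1}},\quad \widehat V_{t+1}^A=\frac{V_{t+1}^A}{1-\beta_2^{t+1}},\quad S_{t+1}^A=\frac{1}{\sqrt{\widehat V_{t+1}^A}+\epsilon}.$$ *)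

theory Defs
  imports Complex_Main "Jordan_Normal_Form.Matrix"
begin

subsection \<open>Element-wise operations, finite sums and the Frobenius norm\<close>

definition hadamard :: "real mat \<Rightarrow> real mat \<Rightarrow> real mat" where
  "hadamard A B = mat (dim_row A) (dim_col A) (\<lambda>(i, j). A $$ (i, j) * B $$ (i, j))"

definition frob_norm :: "real mat \<Rightarrow> real" where
  "frob_norm A = sqrt (\<Sum>i<dim_row A. \<Sum>j<dim_col A. (A $$ (i, j))\<^sup>2)"

(* Matrices of varying size do not form a comm_monoid_add type, so sums of
   r x c matrices are taken in the library's module of r x c matrices. *)
abbreviation mat_sum :: "nat \<Rightarrow> nat \<Rightarrow> (nat \<Rightarrow> real mat) \<Rightarrow> nat set \<Rightarrow> real mat" where
  "mat_sum r c F I \<equiv> finsum (module_mat TYPE(real) r c) F I"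

subsection \<open>Haar approximation coefficients\<close>

(* Rows and columns are counted from 0: for i < s/2, column i carries 1/sqrt 2 in
   rows 2i and 2i+1, and column s/2+i carries 1/sqrt 2 in row 2i and -1/sqrt 2 in
   row 2i+1.  Only used for even s. *)
definition haar_mat :: "nat \<Rightarrow> real mat" where
  "haar_mat s = mat s s (\<lambda>(r, c).
     if c < s div 2 then
       (if r = 2 * c \<or> r = 2 * c + 1 then 1 / sqrt 2 else 0)
     else
       (if r = 2 * (c - s div 2) then 1 / sqrt 2
        else if r = 2 * (c - s div 2) + 1 then - (1 / sqrt 2)
        else 0))"

lemma haar_mat_orthogonal:
  assumes "even s"
  shows "transpose_mat (haar_mat s) * haar_mat s = 1\<^sub>m s"
proof -
  obtain k where s: "s = 2 * k" using assms by blast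
  have pairs: "sum f {0..<2 * k} = (\<Sum>i<k. f (2 * i) + f (2 * i + 1))" for f :: "nat \<Rightarrow> real"
    by (induction k) (auto simp: algebra_simps)
  have even_row: "haar_mat s $$ (2 * i, c) = (if i = (if c < k then c else c - k) then 1 / sqrt 2 else 0)"
    if "i < k" "c < 2 * k" for i c
    using that by (auto simp: haar_mat_def s)
  have odd_row: "haar_mat s $$ (2 * i + 1, c) =
      (if i = (if c < k then c else c - k) then (if c < k then 1 / sqrt 2 else - (1 / sqrt 2)) else 0)"
    if "i < k" "c < 2 * k" for i c
    using that by (auto simp: haar_mat_def s)
  show ?thesis
  proof (rule eq_matI)
    fix a b assume ab: "a < dim_row (1\<^sub>m s :: real mat)" "b < dim_col (1\<^sub>m s :: real mat)"
    have "(transpose_mat (haar_mat s) * haar_mat s) $$ (a, b) =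
        (\<Sum>r\<in>{0..<2 * k}. haar_mat s $$ (r, a) * haar_mat s $$ (r, b))"
      using ab by (simp add: scalar_prod_def s haar_mat_def)
    also have "\<dots> = (\<Sum>i<k. if i = (if a < k then a else a - k) then
        (if a = b then 1 else 0) else 0)"
      unfolding pairs using ab
      by (intro sum.cong refl) (auto simp: even_row[unfolded s] odd_row[unfolded s, simplified] s split: if_splits)
    also have "\<dots> = (if a = b then 1 else 0)"
      using ab by (auto simp: s)
    finally show "(transpose_mat (haar_mat s) * haar_mat s) $$ (a, b) = 1\<^sub>m s $$ (a, b)"
      using ab by simp
  qed (auto simp: haar_mat_def)
qed

(* The pair (A', D') of left and right column halves of A H, i.e. [A', D'] = A H. *)
definition haar_step :: "real mat \<Rightarrow> real mat \<times> real mat" where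
  "haar_step A =
     (let B = A * haar_mat (dim_col A); k = dim_col A div 2 in
       (mat (dim_row A) k (\<lambda>(i, j). B $$ (i, j)),
        mat (dim_row A) k (\<lambda>(i, j). B $$ (i, k + j))))"

fun haar_approx :: "nat \<Rightarrow> real mat \<Rightarrow> real mat" where
  "haar_approx 0 G = G"
| "haar_approx (Suc j) G = fst (haar_step (haar_approx j G))"

lemma haar_approx_carrier:
  assumes "G \<in> carrier_mat m n"
  shows "haar_approx j G \<in> carrier_mat m (n div 2 ^ j)"
proof (induction j)
  case 0
  then show ?case using assms by simp
next
  case (Suc j)
  then show ?case by (auto simp: haar_step_def Let_def div_mult2_eq power_Suc2 simp del: power_Suc)
qed

subsection \<open>Moments and preconditioner\<close>

(* G is the matrix sequence; the moments are m x (n / 2^l) matrices. *)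

fun moment_M :: "nat \<Rightarrow> nat \<Rightarrow> nat \<Rightarrow> real \<Rightarrow> (nat \<Rightarrow> real mat) \<Rightarrow> nat \<Rightarrow> real mat" where
  "moment_M m n l \<beta>1 G 0 = 0\<^sub>m m (n div 2 ^ l)"
| "moment_M m n l \<beta>1 G (Suc t) =
     \<beta>1 \<cdot>\<^sub>m moment_M m n l \<beta>1 G t + (1 - \<beta>1) \<cdot>\<^sub>m haar_approx l (G t)"

fun moment_V :: "nat \<Rightarrow> nat \<Rightarrow> nat \<Rightarrow> real \<Rightarrow> (nat \<Rightarrow> real mat) \<Rightarrow> nat \<Rightarrow> real mat" where
  "moment_V m n l \<beta>2 G 0 = 0\<^sub>m m (n div 2 ^ l)"
| "moment_V m n l \<beta>2 G (Suc t) =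
     \<beta>2 \<cdot>\<^sub>m moment_V m n l \<beta>2 G t + (1 - \<beta>2) \<cdot>\<^sub>m map_mat (\<lambda>x. x\<^sup>2) (haar_approx l (G t))"

(* The bias-corrected quantities are meant for indices t >= 1 only. *)

definition moment_M_hat :: "nat \<Rightarrow> nat \<Rightarrow> nat \<Rightarrow> real \<Rightarrow> (nat \<Rightarrow> real mat) \<Rightarrow> nat \<Rightarrow> real mat" where
  "moment_M_hat m n l \<beta>1 G t = (1 / (1 - \<beta>1 ^ t)) \<cdot>\<^sub>m moment_M m n l \<beta>1 G t"

definition moment_V_hat :: "nat \<Rightarrow> nat \<Rightarrow> nat \<Rightarrow> real \<Rightarrow> (nat \<Rightarrow> real mat) \<Rightarrow> nat \<Rightarrow> real mat" where
  "moment_V_hat m n l \<beta>2 G t = (1 / (1 - \<beta>2 ^ t)) \<cdot>\<^sub>m moment_V m n l \<beta>2 G t"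

definition precond_S ::
  "nat \<Rightarrow> nat \<Rightarrow> nat \<Rightarrow> real \<Rightarrow> real \<Rightarrow> (nat \<Rightarrow> real mat) \<Rightarrow> nat \<Rightarrow> real mat" where
  "precond_S m n l \<beta>2 \<epsilon> G t = map_mat (\<lambda>v. 1 / (sqrt v + \<epsilon>)) (moment_V_hat m n l \<beta>2 G t)"

definition Xi :: "nat \<Rightarrow> nat \<Rightarrow> nat \<Rightarrow> real \<Rightarrow> (nat \<Rightarrow> real mat) \<Rightarrow> nat \<Rightarrow> real mat" where
  "Xi m n l \<beta>1 G t = moment_M_hat m n l \<beta>1 G (t + 1) - haar_approx l (G t)"

definition omega :: "real \<Rightarrow> nat \<Rightarrow> nat \<Rightarrow> real" where
  "omega \<beta>1 t q = (1 - \<beta>1) * \<beta>1 ^ (t - q) / (1 - \<beta>1 ^ (t + 1))"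

definition cc :: "real \<Rightarrow> nat \<Rightarrow> nat \<Rightarrow> real" where
  "cc \<beta>1 t u = \<beta>1 ^ (t - u) * (1 - \<beta>1 ^ (u + 1)) / (1 - \<beta>1 ^ (t + 1))"

end

theory Submission
  imports Defs "HOL-Analysis.L2_Norm"
begin

text \<open>
  Unrolling the recursion gives the weights \<open>\<omega>\<close>. Because these sum to one, the error \<open>\<Xi>\<close> is an average of
  the differences \<open>A\<^sub>q - A\<^sub>t\<close>; summation by parts turns it into a combination of successive increments
  with nonnegative weights, and the bound is the triangle inequality for the Frobenius norm.
\<close>

subsection \<open>Finite sums of matrices\<close>

text \<open>Matrices of one fixed size form an abelian group under the operations of
  \<open>module_mat\<close>. This lemma and the next two restate closure, insertion and the empty
  case of \<open>finsum\<close> in terms of \<open>carrier_mat\<close>, \<open>+\<close> and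
  \<open>0\<^sub>m\<close>, so the later proofs need no locale interpretation.\<close>

lemma mat_sum_carrier:
  assumes "\<And>k. k \<in> I \<Longrightarrow> F k \<in> carrier_mat r c"
  shows "mat_sum r c F I \<in> carrier_mat r c"
proof -
  interpret abelian_monoid "module_mat TYPE(real) r c"
    by (rule abelian_group.axioms(1)[OF abelian_group_mat])
  show ?thesis
    using finsum_closed[of F I] assms by (auto simp: module_mat_simps)
qed

lemma mat_sum_insert:
  assumes "finite I" and "k \<notin> I" and "\<And>i. i \<in> insert k I \<Longrightarrow> F i \<in> carrier_mat r c"
  shows "mat_sum r c F (insert k I) = F k + mat_sum r c F I"
proof -
  interpret abelian_monoid "module_mat TYPE(real) r c"
    by (rule abelian_group.axioms(1)[OF abelian_group_mat])
  show ?thesis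
    using finsum_insert[of I k F] assms by (auto simp: module_mat_simps)
qed

lemma mat_sum_empty: "mat_sum r c F {} = 0\<^sub>m r c"
proof -
  interpret abelian_monoid "module_mat TYPE(real) r c"
    by (rule abelian_group.axioms(1)[OF abelian_group_mat])
  show ?thesis
    by (simp add: module_mat_simps)
qed

text \<open>Reading off an entry is additive, hence passes through the sum by induction on I. This
  is the bridge that reduces the matrix identities below to scalar identities at a fixed
  entry.\<close>

lemma index_mat_sum:
  assumes "finite I" and "\<And>k. k \<in> I \<Longrightarrow> F k \<in> carrier_mat r c" and "i < r" and "j < c"
  shows "mat_sum r c F I $$ (i, j) = (\<Sum>k\<in>I. F k $$ (i, j))"
  using assms(1,2)
proof (induction I)
  case empty
  then show ?case using assms(3,4) by (simp add: mat_sum_empty)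
next
  case (insert k I)
  have "mat_sum r c F I \<in> carrier_mat r c"
    using insert.prems by (intro mat_sum_carrier) auto
  moreover have "mat_sum r c F (insert k I) = F k + mat_sum r c F I"
    using insert by (intro mat_sum_insert) auto
  ultimately show ?case using insert assms(3,4) by simp
qed

subsection \<open>Frobenius norm and element-wise product\<close>

text \<open>Viewing a matrix as a function on index pairs makes the triangle inequality for
  \<open>frob_norm\<close> an instance of the Minkowski inequality for
  \<open>L2_set\<close>.\<close>

lemma frob_norm_eq_L2_set:
  "frob_norm A = L2_set (\<lambda>p. A $$ p) ({..<dim_row A} \<times> {..<dim_col A})"
  by (simp add: frob_norm_def L2_set_def sum.cartesian_product case_prod_unfold)

lemma frob_norm_zero: "frob_norm (0\<^sub>m r c) = 0"
  by (simp add: frob_norm_def)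

lemma frob_norm_triangle:
  assumes "A \<in> carrier_mat r c" and "B \<in> carrier_mat r c"
  shows "frob_norm (A + B) \<le> frob_norm A + frob_norm B"
proof -
  have "frob_norm (A + B) = L2_set (\<lambda>p. A $$ p + B $$ p) ({..<r} \<times> {..<c})"
    unfolding frob_norm_eq_L2_set using assms by (intro L2_set_cong) auto
  also have "\<dots> \<le> frob_norm A + frob_norm B"
    unfolding frob_norm_eq_L2_set using assms L2_set_triangle_ineq by auto
  finally show ?thesis .
qed

lemma frob_norm_smult: "frob_norm (a \<cdot>\<^sub>m A) = \<bar>a\<bar> * frob_norm A"
  by (simp add: frob_norm_def power_mult_distrib real_sqrt_mult flip: sum_distrib_left)

lemma frob_norm_uminus: "frob_norm (- A) = frob_norm A"
  by (simp add: frob_norm_def)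

lemma frob_norm_mat_sum_le:
  assumes "finite I" and "\<And>k. k \<in> I \<Longrightarrow> F k \<in> carrier_mat r c"
  shows "frob_norm (mat_sum r c F I) \<le> (\<Sum>k\<in>I. frob_norm (F k))"
  using assms
proof (induction I)
  case empty
  then show ?case by (simp add: mat_sum_empty frob_norm_zero)
next
  case (insert k I)
  have "mat_sum r c F (insert k I) = F k + mat_sum r c F I"
    using insert by (intro mat_sum_insert) auto
  then have "frob_norm (mat_sum r c F (insert k I)) \<le> frob_norm (F k) + frob_norm (mat_sum r c F I)"
    using insert.prems by (auto intro!: frob_norm_triangle[of _ r c] mat_sum_carrier)
  also have "\<dots> \<le> (\<Sum>k\<in>insert k I. frob_norm (F k))"
    using insert by simp
  finally show ?case .
qed

lemma hadamard_carrier: "P \<in> carrier_mat r c \<Longrightarrow> hadamard P A \<in> carrier_mat r c"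
  by (simp add: hadamard_def)

lemma hadamard_uminus:
  assumes "P \<in> carrier_mat r c" and "A \<in> carrier_mat r c"
  shows "hadamard P (- A) = - hadamard P A"
  using assms by (auto simp: hadamard_def)

lemma hadamard_smult:
  assumes "P \<in> carrier_mat r c" and "A \<in> carrier_mat r c"
  shows "hadamard P (a \<cdot>\<^sub>m A) = a \<cdot>\<^sub>m hadamard P A"
  using assms by (auto simp: hadamard_def)

lemma hadamard_mat_sum:
  assumes P: "P \<in> carrier_mat r c" and "finite I" and F: "\<And>k. k \<in> I \<Longrightarrow> F k \<in> carrier_mat r c"
  shows "hadamard P (mat_sum r c F I) = mat_sum r c (\<lambda>k. hadamard P (F k)) I"
proof (rule eq_matI)
  have R: "mat_sum r c (\<lambda>k. hadamard P (F k)) I \<in> carrier_mat r c"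
    by (intro mat_sum_carrier hadamard_carrier P)
  then show "dim_row (hadamard P (mat_sum r c F I)) = dim_row (mat_sum r c (\<lambda>k. hadamard P (F k)) I)"
    and "dim_col (hadamard P (mat_sum r c F I)) = dim_col (mat_sum r c (\<lambda>k. hadamard P (F k)) I)"
    using P by (auto simp: hadamard_def)
  fix i j
  assume "i < dim_row (mat_sum r c (\<lambda>k. hadamard P (F k)) I)"
    and "j < dim_col (mat_sum r c (\<lambda>k. hadamard P (F k)) I)"
  then have ij: "i < r" "j < c" using R by auto
  have "mat_sum r c (\<lambda>k. hadamard P (F k)) I $$ (i, j) = (\<Sum>k\<in>I. hadamard P (F k) $$ (i, j))"
    using assms ij by (intro index_mat_sum hadamard_carrier)
  also have "\<dots> = P $$ (i, j) * (\<Sum>k\<in>I. F k $$ (i, j))"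
    using P ij by (simp add: hadamard_def sum_distrib_left)
  finally show "hadamard P (mat_sum r c F I) $$ (i, j) = mat_sum r c (\<lambda>k. hadamard P (F k)) I $$ (i, j)"
    using assms ij by (simp add: hadamard_def index_mat_sum)
qed

text \<open>The element-wise product with a fixed P is linear, so it moves inside the combination;
  the norm absorbs the outer sign, and the triangle inequality splits the sum. Homogeneity yields
  the factor |a k|, which is a k because the weights are nonnegative.\<close>

lemma frob_norm_hadamard_combination_le:
  assumes P: "P \<in> carrier_mat r c" and "finite I" and F: "\<And>k. k \<in> I \<Longrightarrow> F k \<in> carrier_mat r c"
    and a: "\<And>k. k \<in> I \<Longrightarrow> 0 \<le> a k"
  shows "frob_norm (hadamard P (- mat_sum r c (\<lambda>k. a k \<cdot>\<^sub>m F k) I))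
    \<le> (\<Sum>k\<in>I. a k * frob_norm (hadamard P (F k)))"
proof -
  have "frob_norm (hadamard P (- mat_sum r c (\<lambda>k. a k \<cdot>\<^sub>m F k) I))
      = frob_norm (mat_sum r c (\<lambda>k. hadamard P (a k \<cdot>\<^sub>m F k)) I)"
    using assms
    by (subst hadamard_uminus[OF P]) (auto simp: frob_norm_uminus hadamard_mat_sum intro!: mat_sum_carrier)
  also have "\<dots> \<le> (\<Sum>k\<in>I. frob_norm (hadamard P (a k \<cdot>\<^sub>m F k)))"
    using assms by (intro frob_norm_mat_sum_le hadamard_carrier)
  also have "\<dots> = (\<Sum>k\<in>I. a k * frob_norm (hadamard P (F k)))"
    using F a by (intro sum.cong refl) (simp add: hadamard_smult[OF P] frob_norm_smult)
  finally show ?thesis .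
qed

subsection \<open>Exponential averages\<close>

text \<open>This matches the explicit weighted sum with the moment recursion: one more step
  multiplies every old weight by b and gives the newest term weight 1 - b.\<close>

lemma exp_average_sum_Suc:
  fixes b :: real
  shows "(\<Sum>q\<le>Suc t. (1 - b) * b ^ (Suc t - q) * a q)
    = b * (\<Sum>q\<le>t. (1 - b) * b ^ (t - q) * a q) + (1 - b) * a (Suc t)"
proof -
  have "(\<Sum>q\<le>t. (1 - b) * b ^ (Suc t - q) * a q) = (\<Sum>q\<le>t. b * ((1 - b) * b ^ (t - q) * a q))"
    by (intro sum.cong refl) (simp add: Suc_diff_le)
  then show ?thesis by (simp add: sum_distrib_left)
qed

text \<open>Summation by parts with the bias-correction denominator cleared; 1 - b^(t+1) is the
  total of the weights. Writing E t for the left-hand side, both sides satisfy E (t+1) = b * E t - b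
  * (1 - b^(t+1)) * (a (t+1) - a t), starting from E 0 = 0.\<close>

lemma exp_average_by_parts:
  fixes b :: real
  shows "(\<Sum>q\<le>t. (1 - b) * b ^ (t - q) * a q) - (1 - b ^ (t + 1)) * a t
    = - (\<Sum>u<t. b ^ (t - u) * (1 - b ^ (u + 1)) * (a (u + 1) - a u))"
proof (induction t)
  case 0
  then show ?case by simp
next
  case (Suc t)
  \<comment> \<open>For u < t the truncated subtraction gives Suc t - u = Suc (t - u), so one factor
    b comes out. The remaining term u = t of the new sum is split off in the last step.\<close>
  have "(\<Sum>u<t. b ^ (Suc t - u) * (1 - b ^ (u + 1)) * (a (u + 1) - a u))
      = b * (\<Sum>u<t. b ^ (t - u) * (1 - b ^ (u + 1)) * (a (u + 1) - a u))"
    unfolding sum_distrib_left by (intro sum.cong refl) (simp add: Suc_diff_le)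
  also have "\<dots> = - b * ((\<Sum>q\<le>t. (1 - b) * b ^ (t - q) * a q) - (1 - b ^ (t + 1)) * a t)"
    unfolding Suc.IH by simp
  finally show ?case
    by (subst exp_average_sum_Suc) (simp add: algebra_simps)
qed

section \<open>Moments and the averaging error as weighted matrix sums\<close>

lemma moment_M_carrier:
  assumes "\<And>t. G t \<in> carrier_mat m n"
  shows "moment_M m n l b G t \<in> carrier_mat m (n div 2 ^ l)"
  by (induction t) (auto simp: haar_approx_carrier[OF assms])

lemma moment_V_carrier:
  assumes "\<And>t. G t \<in> carrier_mat m n"
  shows "moment_V m n l b G t \<in> carrier_mat m (n div 2 ^ l)"
  by (induction t) (auto simp: haar_approx_carrier[OF assms])

text \<open>The moment with index Suc t has averaged the coefficients of steps 0 to t. Since the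
  recursion starts from the zero matrix, no initial term survives.\<close>

lemma index_moment_M:
  assumes G: "\<And>t. G t \<in> carrier_mat m n" and ij: "i < m" "j < n div 2 ^ l"
  shows "moment_M m n l b G (Suc t) $$ (i, j)
    = (\<Sum>q\<le>t. (1 - b) * b ^ (t - q) * haar_approx l (G q) $$ (i, j))"
proof (induction t)
  case 0
  then show ?case using ij by (simp add: carrier_matD[OF haar_approx_carrier[OF G]])
next
  case (Suc t)
  \<comment> \<open>Only the outermost step of the recursion is unfolded, so that the inner moment
    keeps the index Suc t of the induction hypothesis.\<close>
  have "moment_M m n l b G (Suc (Suc t)) $$ (i, j)
      = b * moment_M m n l b G (Suc t) $$ (i, j) + (1 - b) * haar_approx l (G (Suc t)) $$ (i, j)"
    using ij carrier_matD[OF haar_approx_carrier[OF G]] carrier_matD[OF moment_M_carrier[OF G]]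
    by (subst moment_M.simps) (simp del: moment_M.simps)
  then show ?case unfolding Suc.IH exp_average_sum_Suc .
qed

lemma moment_M_hat_eq_mat_sum:
  assumes G: "\<And>t. G t \<in> carrier_mat m n"
  shows "moment_M_hat m n l b G (t + 1)
    = mat_sum m (n div 2 ^ l) (\<lambda>q. omega b t q \<cdot>\<^sub>m haar_approx l (G q)) {..t}"
    (is "?L = ?R")
proof (rule eq_matI)
  note A = haar_approx_carrier[OF G, of l]
  have L: "?L \<in> carrier_mat m (n div 2 ^ l)"
    using moment_M_carrier[OF G] by (simp add: moment_M_hat_def del: moment_M.simps)
  have R: "?R \<in> carrier_mat m (n div 2 ^ l)"
    using A by (intro mat_sum_carrier) auto
  show "dim_row ?L = dim_row ?R" "dim_col ?L = dim_col ?R"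
    using L R by auto
  fix i j assume "i < dim_row ?R" "j < dim_col ?R"
  then have ij: "i < m" "j < n div 2 ^ l" using R by auto
  have "?L $$ (i, j)
      = (\<Sum>q\<le>t. (1 - b) * b ^ (t - q) * haar_approx l (G q) $$ (i, j)) / (1 - b ^ (t + 1))"
    using ij carrier_matD[OF moment_M_carrier[OF G]]
    by (simp add: moment_M_hat_def index_moment_M[OF G] del: moment_M.simps)
  also have "\<dots> = (\<Sum>q\<le>t. (omega b t q \<cdot>\<^sub>m haar_approx l (G q)) $$ (i, j))"
    using ij carrier_matD[OF A] by (simp add: omega_def sum_divide_distrib)
  also have "\<dots> = ?R $$ (i, j)"
    using ij A by (intro index_mat_sum[symmetric]) auto
  finally show "?L $$ (i, j) = ?R $$ (i, j)" .
qed

lemma Xi_eq_mat_sum: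
  assumes G: "\<And>t. G t \<in> carrier_mat m n" and b: "0 \<le> b" "b < 1"
  shows "Xi m n l b G t
    = - mat_sum m (n div 2 ^ l)
          (\<lambda>u. cc b t u \<cdot>\<^sub>m (haar_approx l (G (u + 1)) - haar_approx l (G u))) {..<t}"
    (is "?L = - ?R")
proof (rule eq_matI)
  note A = haar_approx_carrier[OF G, of l]
  have D: "cc b t u \<cdot>\<^sub>m (haar_approx l (G (u + 1)) - haar_approx l (G u)) \<in> carrier_mat m (n div 2 ^ l)" for u
    by (intro smult_carrier_mat minus_carrier_mat A)
  have R: "?R \<in> carrier_mat m (n div 2 ^ l)"
    using D by (rule mat_sum_carrier)
  show "dim_row ?L = dim_row (- ?R)" "dim_col ?L = dim_col (- ?R)"
    using carrier_matD[OF A] carrier_matD[OF R] by (auto simp: Xi_def)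
  fix i j assume "i < dim_row (- ?R)" "j < dim_col (- ?R)"
  then have ij: "i < m" "j < n div 2 ^ l" using R by auto
  let ?a = "\<lambda>q. haar_approx l (G q) $$ (i, j)"
  \<comment> \<open>The denominator must be nonzero here: \<open>?a t\<close> is rewritten as (1 -
    b^(t+1)) * \<open>?a t\<close> over that denominator, which produces the left-hand side of
    \<open>exp_average_by_parts\<close>.\<close>
  have "b ^ (t + 1) < 1"
    using b by (intro power_less_one_iff[THEN iffD2]) auto
  then have nz: "1 - b ^ (t + 1) \<noteq> 0" by simp
  have "?L $$ (i, j) = (\<Sum>q\<le>t. (1 - b) * b ^ (t - q) * ?a q) / (1 - b ^ (t + 1)) - ?a t"
    using ij carrier_matD[OF A] carrier_matD[OF moment_M_carrier[OF G]]
    by (simp add: Xi_def moment_M_hat_def index_moment_M[OF G] del: moment_M.simps)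
  also have "\<dots> = ((\<Sum>q\<le>t. (1 - b) * b ^ (t - q) * ?a q) - (1 - b ^ (t + 1)) * ?a t) / (1 - b ^ (t + 1))"
    using nz by (simp add: diff_divide_distrib)
  also have "\<dots> = - (\<Sum>u<t. cc b t u * (?a (u + 1) - ?a u))"
    unfolding exp_average_by_parts[of b t ?a] by (simp add: cc_def sum_divide_distrib)
  also have "\<dots> = - (\<Sum>u<t. (cc b t u \<cdot>\<^sub>m (haar_approx l (G (u + 1)) - haar_approx l (G u))) $$ (i, j))"
    using ij carrier_matD[OF A] by simp
  also have "\<dots> = (- ?R) $$ (i, j)"
    using ij D carrier_matD[OF R] by (simp add: index_mat_sum)
  finally show "?L $$ (i, j) = (- ?R) $$ (i, j)" .
qed

text \<open>With this sign the triangle inequality yields the weights \<open>cc\<close> themselves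
  instead of their absolute values.\<close>

lemma cc_nonneg:
  assumes "0 \<le> b" and "b < 1"
  shows "0 \<le> cc b t u"
  using assms unfolding cc_def
  by (intro divide_nonneg_nonneg mult_nonneg_nonneg) (auto intro: power_le_one simp del: power_Suc)

theorem lemma3p2:
  fixes m n l :: nat and \<beta>1 \<beta>2 \<epsilon> :: real and G :: "nat \<Rightarrow> real mat"
  assumes "m \<ge> 1" and "n \<ge> 1" and "l \<ge> 1" and "2 ^ l dvd n"
    and "0 \<le> \<beta>1" and "\<beta>1 < 1" and "0 \<le> \<beta>2" and "\<beta>2 < 1" and "\<epsilon> > 0"
    and "\<And>t. G t \<in> carrier_mat m n"
  shows "\<forall>t.
      moment_M_hat m n l \<beta>1 G (t + 1) =
        mat_sum m (n div 2 ^ l) (\<lambda>q. omega \<beta>1 t q \<cdot>\<^sub>m haar_approx l (G q)) {..t}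
    \<and> Xi m n l \<beta>1 G t =
        - mat_sum m (n div 2 ^ l)
            (\<lambda>u. cc \<beta>1 t u \<cdot>\<^sub>m (haar_approx l (G (u + 1)) - haar_approx l (G u))) {..<t}
    \<and> frob_norm (hadamard (map_mat sqrt (precond_S m n l \<beta>2 \<epsilon> G (t + 1))) (Xi m n l \<beta>1 G t))
        \<le> (\<Sum>u<t. cc \<beta>1 t u *
             frob_norm (hadamard (map_mat sqrt (precond_S m n l \<beta>2 \<epsilon> G (t + 1)))
                                 (haar_approx l (G (u + 1)) - haar_approx l (G u))))
    \<and> (t = 0 \<longrightarrow>
        frob_norm (hadamard (map_mat sqrt (precond_S m n l \<beta>2 \<epsilon> G (t + 1))) (Xi m n l \<beta>1 G t)) = 0
      \<and> (\<Sum>u<t. cc \<beta>1 t u *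
             frob_norm (hadamard (map_mat sqrt (precond_S m n l \<beta>2 \<epsilon> G (t + 1)))
                                 (haar_approx l (G (u + 1)) - haar_approx l (G u)))) = 0)"
proof (intro allI)
  fix t
  note G = assms(10)
  let ?P = "map_mat sqrt (precond_S m n l \<beta>2 \<epsilon> G (t + 1))"
  let ?D = "\<lambda>u. haar_approx l (G (u + 1)) - haar_approx l (G u)"
  have P: "?P \<in> carrier_mat m (n div 2 ^ l)"
    using moment_V_carrier[OF G] by (simp add: precond_S_def moment_V_hat_def del: moment_V.simps)
  have D: "?D u \<in> carrier_mat m (n div 2 ^ l)" for u
    by (intro minus_carrier_mat haar_approx_carrier G)
  have M: "moment_M_hat m n l \<beta>1 G (t + 1) =
      mat_sum m (n div 2 ^ l) (\<lambda>q. omega \<beta>1 t q \<cdot>\<^sub>m haar_approx l (G q)) {..t}"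
    using G by (rule moment_M_hat_eq_mat_sum)
  have Xi: "Xi m n l \<beta>1 G t = - mat_sum m (n div 2 ^ l) (\<lambda>u. cc \<beta>1 t u \<cdot>\<^sub>m ?D u) {..<t}"
    using G \<open>0 \<le> \<beta>1\<close> \<open>\<beta>1 < 1\<close> by (rule Xi_eq_mat_sum)
  have le: "frob_norm (hadamard ?P (Xi m n l \<beta>1 G t))
      \<le> (\<Sum>u<t. cc \<beta>1 t u * frob_norm (hadamard ?P (?D u)))"
    unfolding Xi using P D \<open>0 \<le> \<beta>1\<close> \<open>\<beta>1 < 1\<close>
    by (intro frob_norm_hadamard_combination_le cc_nonneg) auto
  \<comment> \<open>For t = 0 the bound is an empty sum, so nonnegativity of the norm squeezes the
    left-hand side to zero.\<close>
  have "0 \<le> frob_norm (hadamard ?P (Xi m n l \<beta>1 G t))"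
    by (simp add: frob_norm_eq_L2_set)
  with le have "t = 0 \<longrightarrow> frob_norm (hadamard ?P (Xi m n l \<beta>1 G t)) = 0
      \<and> (\<Sum>u<t. cc \<beta>1 t u * frob_norm (hadamard ?P (?D u))) = 0"
    by auto
  with M Xi le
  show "moment_M_hat m n l \<beta>1 G (t + 1) =
        mat_sum m (n div 2 ^ l) (\<lambda>q. omega \<beta>1 t q \<cdot>\<^sub>m haar_approx l (G q)) {..t}
    \<and> Xi m n l \<beta>1 G t = - mat_sum m (n div 2 ^ l) (\<lambda>u. cc \<beta>1 t u \<cdot>\<^sub>m ?D u) {..<t}
    \<and> frob_norm (hadamard ?P (Xi m n l \<beta>1 G t))
        \<le> (\<Sum>u<t. cc \<beta>1 t u * frob_norm (hadamard ?P (?D u)))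
    \<and> (t = 0 \<longrightarrow> frob_norm (hadamard ?P (Xi m n l \<beta>1 G t)) = 0
      \<and> (\<Sum>u<t. cc \<beta>1 t u * frob_norm (hadamard ?P (?D u))) = 0)"
    by (intro conjI)
qed

end
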